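(* Let $X=X_\Sigma$ be the $n$-dimensional toric variety of a complete fan $\Sigma$ in $\mathbb{R}^n$ with $k$ rays, let $f,g\in S=\mathbb{C}[x_1,\dots,x_k]$ be nonzero homogeneous polynomials with positive coefficients and the same degree in $\mathrm{Cl}(X)$, with $\dim\mathcal{N}(g)=n$ and $\mathcal{N}(f)$ contained in the relative interior of $\mathcal{N}(g)$. Let $\mathcal{F}$ be a simplicial refinement of the normal fan of $\mathcal{N}(f)+\mathcal{N}(g)$ in $\mathbb{R}^k/K$, $K=\ker V$, and let $\sigma\in\mathcal{F}(n)$ be a maximal cone. Let $W=[w_1\,\cdots\,w_n]\in\mathbb{R}^{k\times n}$ be a matrix whose columns (modulo $K$) generate $\sigma$, ordered so that $\det(VW)>0$. Let $\nu_f,\nu_g$ be vertices of the faces of $\mathcal{N}(f)$ and $\mathcal{N}(g)$ corresponding to $\sigma$, and set $\delta_\sigma=\nu_g-\nu_f$. Then the tropical sector integral equals $$\mathcal{I}^{\rm tr}_\sigma:=\int_{\mathrm{Exp}(\sigma)}\frac{f^{\rm tr}}{g^{\rm tr}}\,\Omega_X\;=\;\frac{\det(VW)}{\prod_{\ell=1}^n w_\ell\cdot\delta_\sigma}.$$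
   Context: Let $\Sigma$ be a complete rational polyhedral fan in $\mathbb{R}^n$ with primitive ray generators $v_1,\dots,v_k\in\mathbb{Z}^n$, and $V=[v_1\,\cdots\,v_k]\in\mathbb{Z}^{n\times k}$. Let $X=X_\Sigma$ be the associated toric variety with dense torus $T=(\mathbb{C}^* )^n$ (coordinates $t_j$). The Cox ring $S=\mathbb{C}[x_1,\dots,x_k]$ is graded by $\mathrm{Cl}(X)=\mathbb{Z}^k/\mathrm{im}(V^\top)$ with $\deg x_i$ the class of the $i$-th unit vector. The Cox quotient map $\pi$ is given on $(\mathbb{C}^* )^k$ by $x\mapsto(\prod_i x_i^{(v_i)_j})_{j=1,\dots,n}\in T$, and $X_{>0}=\pi(\mathbb{R}^k_{>0})\simeq\mathbb{R}^n_{>0}$. The canonical form is $\Omega_X=\sum_{|I|=n}\det(V_I)\bigwedge_{i\in I}\frac{\mathrm{d}x_i}{x_i}$; it is the pullback under $\pi$ of $\bigwedge_{j=1}^n\mathrm{d}t_j/t_j$, is viewed as a form on $X$, and $X_{>0}$ is oriented so that it is positive. For a polynomial $f$ with positive coefficients, $\mathrm{supp}(f)$ is its set of exponent vectors, $\mathcal{N}(f)\subset\mathbb{R}^k$ its Newton polytope, and its tropical approximation is $f^{\rm tr}:\mathbb{R}^k_{>0}\to\mathbb{R}_{>0}$, $f^{\rm tr}(x)=\max_{\ell\in\mathrm{supp}(f)}x^\ell$. If $f,g$ are homogeneous of the same degree, $f^{\rm tr}/g^{\rm tr}$ is constant on the fibres of $\pi:\mathbb{R}^k_{>0}\to X_{>0}$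 and is viewed as a function on $X_{>0}$. Let $K=\ker(V)\subset\mathbb{R}^k$, of dimension $k-n$. Normal fans use the max convention: the cone of a face $F$ of a polytope $Q$ consists of the $y$ for which $y\cdot\nu$ is maximized over $Q$ on $F$. The normal fan of the $n$-dimensional polytope $\mathcal{N}(f)+\mathcal{N}(g)=\mathcal{N}(fg)$ has lineality space $K$ and is viewed as a complete pointed fan in $\mathbb{R}^k/K\simeq\mathbb{R}^n$; $\mathcal{F}$ is a simplicial fan refining it, and $\mathcal{F}(n)$ its set of $n$-dimensional cones. The face of $\mathcal{N}(f)$ (resp. $\mathcal{N}(g)$) corresponding to $\sigma$ is the set of points maximizing $y\cdot\nu$ for $y$ in the relative interior of $\sigma$. The exponential map is $\mathrm{Exp}:\mathbb{R}^k/K\to X_{>0}$, $[y]\mapsto\pi(e^{y_1},\dots,e^{y_k})$, a well-defined bijection. The quantities $\det(VW)$ and $w_\ell\cdot\delta_\sigma$ do not depend on the representatives of $w_\ell$ modulo $K$. *)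

theory Defs
  imports "HOL-Analysis.Analysis" "HOL-Library.Poly_Mapping"
begin

text \<open>The type \<^typ>\<open>'k\<close> indexes the \<open>k\<close> rays of the fan and \<^typ>\<open>'n\<close> the coordinates
  of the \<open>n\<close>-dimensional ambient space, so the ray matrix is \<open>V :: int^'k^'n\<close> and \<open>v\<^sub>i\<close> is
  \<open>column i V\<close>.\<close>

section \<open>Fans\<close>

text \<open>A fan in the quotient of a Euclidean space by a linear subspace \<open>K\<close>. A cone of the quotient
  is represented by its preimage, i.e. by a polyhedral cone with lineality space \<open>K\<close>; the case
  \<open>K = {0}\<close> is the usual notion of a fan of pointed polyhedral cones.\<close>

definition fan_mod :: "'a::euclidean_space set \<Rightarrow> 'a set set \<Rightarrow> bool" where
  "fan_mod K F \<longleftrightarrow> finite F \<and>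
     (\<forall>\<sigma>\<in>F. polyhedron \<sigma> \<and> convex_cone \<sigma> \<and> \<sigma> \<inter> uminus ` \<sigma> = K) \<and>
     (\<forall>\<sigma>\<in>F. \<forall>\<tau>. \<tau> face_of \<sigma> \<and> \<tau> \<noteq> {} \<longrightarrow> \<tau> \<in> F) \<and>
     (\<forall>\<sigma>\<in>F. \<forall>\<tau>\<in>F. (\<sigma> \<inter> \<tau>) face_of \<sigma> \<and> (\<sigma> \<inter> \<tau>) face_of \<tau>)"

definition complete_fan :: "'a::euclidean_space set set \<Rightarrow> bool" where
  "complete_fan F \<longleftrightarrow> \<Union>F = UNIV"

definition rational_cone :: "(real^'n) set \<Rightarrow> bool" where
  "rational_cone \<sigma> \<longleftrightarrow> (\<exists>G. finite G \<and> (\<forall>u\<in>G. \<forall>j. u $ j \<in> \<int>) \<and> \<sigma> = convex_cone hull G)"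

definition real_mat :: "int^'k^'n \<Rightarrow> real^'k^'n" where
  "real_mat V = map_matrix real_of_int V"

definition primitive :: "int^'n \<Rightarrow> bool" where
  "primitive v \<longleftrightarrow> (GCD j. v $ j) = 1"

definition ray_matrix :: "(real^'n) set set \<Rightarrow> int^'k^'n \<Rightarrow> bool" where
  "ray_matrix \<Sigma> V \<longleftrightarrow>
     (\<forall>i. primitive (column i V)) \<and>
     bij_betw (\<lambda>i. convex_cone hull {column i (real_mat V)}) UNIV {\<rho>\<in>\<Sigma>. aff_dim \<rho> = 1}"

definition ker_mat :: "real^'k^'n \<Rightarrow> (real^'k) set" where
  "ker_mat A = {u. A *v u = 0}"

definition cone_mod :: "'a::euclidean_space set \<Rightarrow> 'a set \<Rightarrow> 'a set" where
  "cone_mod K S = {u + y |u y. u \<in> K \<and> y \<in> convex_cone hull S}"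

definition independent_mod :: "'a::euclidean_space set \<Rightarrow> 'a set \<Rightarrow> bool" where
  "independent_mod K S \<longleftrightarrow> finite S \<and>
     (\<forall>c. (\<Sum>s\<in>S. c s *\<^sub>R s) \<in> K \<longrightarrow> (\<forall>s\<in>S. c s = 0))"

definition simplicial_fan_mod :: "'a::euclidean_space set \<Rightarrow> 'a set set \<Rightarrow> bool" where
  "simplicial_fan_mod K F \<longleftrightarrow> fan_mod K F \<and> (\<forall>\<sigma>\<in>F. \<exists>S. independent_mod K S \<and> \<sigma> = cone_mod K S)"

definition refines_fan :: "'a::euclidean_space set set \<Rightarrow> 'a set set \<Rightarrow> bool" where
  "refines_fan F N \<longleftrightarrow> \<Union>F = \<Union>N \<and> (\<forall>\<sigma>\<in>F. \<exists>\<tau>\<in>N. \<sigma> \<subseteq> \<tau>)"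

text \<open>The cones of the fan whose image in the quotient by \<open>K\<close> has dimension \<open>m\<close>.\<close>

definition cones_of_dim_mod :: "'a::euclidean_space set \<Rightarrow> 'a set set \<Rightarrow> nat \<Rightarrow> 'a set set" where
  "cones_of_dim_mod K F m = {\<sigma>\<in>F. aff_dim \<sigma> = int (m + dim K)}"

section \<open>Normal fans\<close>

definition normal_cone :: "'a::euclidean_space set \<Rightarrow> 'a set \<Rightarrow> 'a set" where
  "normal_cone Q F = {y. \<forall>\<nu>\<in>F. \<forall>\<mu>\<in>Q. y \<bullet> \<mu> \<le> y \<bullet> \<nu>}"

definition normal_fan :: "'a::euclidean_space set \<Rightarrow> 'a set set" where
  "normal_fan Q = {normal_cone Q F |F. F face_of Q \<and> F \<noteq> {}}"

definition face_of_cone :: "'a::euclidean_space set \<Rightarrow> 'a set \<Rightarrow> 'a set" where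
  "face_of_cone Q \<sigma> = {\<nu>\<in>Q. \<forall>y\<in>rel_interior \<sigma>. \<forall>\<mu>\<in>Q. y \<bullet> \<mu> \<le> y \<bullet> \<nu>}"

definition minkowski_sum :: "'a::real_vector set \<Rightarrow> 'a set \<Rightarrow> 'a set" where
  "minkowski_sum A B = {a + b |a b. a \<in> A \<and> b \<in> B}"

section \<open>The Cox ring\<close>

type_synonym 'k cox_ring = "('k \<Rightarrow>\<^sub>0 nat) \<Rightarrow>\<^sub>0 complex"

definition int_exponent :: "('k::finite \<Rightarrow>\<^sub>0 nat) \<Rightarrow> int^'k" where
  "int_exponent m = (\<chi> i. int (Poly_Mapping.lookup m i))"

definition real_exponent :: "('k::finite \<Rightarrow>\<^sub>0 nat) \<Rightarrow> real^'k" where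
  "real_exponent m = (\<chi> i. real (Poly_Mapping.lookup m i))"

definition class_rel :: "int^'k^'n \<Rightarrow> ((int^'k) \<times> (int^'k)) set" where
  "class_rel V = {(a, b). \<exists>u. b - a = transpose V *v u}"

definition class_group :: "int^'k^'n \<Rightarrow> (int^'k) set set" where
  "class_group V = UNIV // class_rel V"

definition homogeneous :: "int^'k^'n \<Rightarrow> (int^'k) set \<Rightarrow> 'k cox_ring \<Rightarrow> bool" where
  "homogeneous V d f \<longleftrightarrow> (\<forall>m\<in>Poly_Mapping.keys f. class_rel V `` {int_exponent m} = d)"

definition positive_coeffs :: "'k cox_ring \<Rightarrow> bool" where
  "positive_coeffs f \<longleftrightarrow>
     (\<forall>m\<in>Poly_Mapping.keys f. Poly_Mapping.lookup f m \<in> \<real> \<and> Re (Poly_Mapping.lookup f m) > 0)"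

definition newton_polytope :: "'k::finite cox_ring \<Rightarrow> (real^'k) set" where
  "newton_polytope f = convex hull (real_exponent ` Poly_Mapping.keys f)"

definition trop :: "'k::finite cox_ring \<Rightarrow> real^'k \<Rightarrow> real" where
  "trop f x = Max ((\<lambda>m. \<Prod>i\<in>UNIV. x $ i ^ Poly_Mapping.lookup m i) ` Poly_Mapping.keys f)"

section \<open>The positive part of the toric variety\<close>

text \<open>The positive part of the toric variety is the image of the positive orthant under the Cox
  quotient map. It lies in the dense torus, and its points are given by their (positive) torus
  coordinates.\<close>

definition pos_orthant :: "(real^'k) set" where
  "pos_orthant = {x. \<forall>i. 0 < x $ i}"

definition cox_map :: "int^'k^'n \<Rightarrow> real^'k \<Rightarrow> real^'n" where
  "cox_map V x = (\<chi> j. \<Prod>i\<in>UNIV. x $ i powi (V $ j $ i))"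

text \<open>The exponential map, on representatives in \<open>\<real>\<^sup>k\<close> of classes modulo the kernel of \<open>V\<close>.\<close>

definition Exp_map :: "int^'k^'n \<Rightarrow> real^'k \<Rightarrow> real^'n" where
  "Exp_map V y = cox_map V (\<chi> i. exp (y $ i))"

text \<open>A function on the positive orthant that is constant on the fibres of the Cox map, viewed as a
  function on the positive part.\<close>

definition descend_fun :: "int^'k^'n \<Rightarrow> (real^'k \<Rightarrow> real) \<Rightarrow> real^'n \<Rightarrow> real" where
  "descend_fun V h t = (THE c. \<forall>x\<in>pos_orthant. cox_map V x = t \<longrightarrow> h x = c)"

section \<open>The canonical form\<close>

text \<open>A differential \<open>n\<close>-form is a function of a point and an \<open>n\<close>-tuple of tangent vectors; the tuple
  \<open>\<xi>\<close> is indexed by \<^typ>\<open>'n\<close>, and \<open>\<xi> $ b\<close> is its \<open>b\<close>-th vector.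

  For a set \<open>I\<close> of \<open>n\<close> ray indices and an enumeration \<open>e\<close> of \<open>I\<close> by \<^typ>\<open>'n\<close>, the value
  of \<open>\<And>\<^bsub>i\<in>I\<^esub> dx\<^sub>i\<close> at \<open>\<xi>\<close> is the determinant of the \<open>I\<close>-coordinates of \<open>\<xi>\<close>. The sign of the
  enumeration cancels against the one in \<open>det V\<^sub>I\<close>, so its choice is immaterial.\<close>

definition enum_subset :: "'k set \<Rightarrow> 'n \<Rightarrow> 'k" where
  "enum_subset I = (SOME e. bij_betw e UNIV I)"

definition cox_form :: "int^'k^'n \<Rightarrow> real^'k \<Rightarrow> (real^'k)^'n \<Rightarrow> real" where
  "cox_form V x \<xi> =
     (\<Sum>I | card I = CARD('n).
        let e = enum_subset I in
          det (\<chi> a b. real_mat V $ a $ e b) *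
          (det (\<chi> a b. \<xi> $ b $ e a) / (\<Prod>i\<in>I. x $ i)))"

text \<open>The form on the positive part whose pullback under the Cox map is \<^term>\<open>cox_form V\<close>.\<close>

definition canonical_form :: "int^'k^'n \<Rightarrow> real^'n \<Rightarrow> (real^'n)^'n \<Rightarrow> real" where
  "canonical_form V t \<eta> =
     (THE c. \<forall>x\<in>pos_orthant. \<forall>\<xi>. cox_map V x = t \<and>
        (\<forall>b. frechet_derivative (cox_map V) (at x) (\<xi> $ b) = \<eta> $ b) \<longrightarrow> cox_form V x \<xi> = c)"

text \<open>The integral of the \<open>n\<close>-form \<open>h \<omega>\<close> over \<open>A \<subseteq> \<real>\<^sup>n\<close>, with the orientation of \<open>dt\<^sub>1 \<and> \<dots> \<and> dt\<^sub>n\<close>.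
  The density \<open>\<omega> t (\<chi> b. axis b 1)\<close> is the coefficient of \<open>\<omega>\<close> with respect to \<open>dt\<^sub>1 \<and> \<dots> \<and> dt\<^sub>n\<close>.
  By \<open>canonical_form_eq\<close> below, this is the orientation making the canonical form positive.\<close>

definition form_integral ::
  "(real^'n) set \<Rightarrow> (real^'n \<Rightarrow> real) \<Rightarrow> (real^'n \<Rightarrow> (real^'n)^'n \<Rightarrow> real) \<Rightarrow> real" where
  "form_integral A h \<omega> = (LINT t:A|lborel. h t * \<omega> t (\<chi> b. axis b 1))"

definition tropical_sector_integral ::
  "int^'k^'n \<Rightarrow> 'k::finite cox_ring \<Rightarrow> 'k cox_ring \<Rightarrow> (real^'k) set \<Rightarrow> real" where
  "tropical_sector_integral V f g \<sigma> =
     form_integral (Exp_map V ` \<sigma>) (descend_fun V (\<lambda>x. trop f x / trop g x)) (canonical_form V)"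

section \<open>Well-definedness of the descended function and form\<close>

lemma cauchy_binet_sum:
  fixes A :: "real^'k^'n" and B :: "real^'n^'k"
  shows "det (A ** B) = (\<Sum>I | card I = CARD('n). det (\<chi> a b. A $ a $ enum_subset I b) * det (\<chi> a b. B $ enum_subset I a $ b))"
proof -
  define G :: "('n \<Rightarrow> 'k) \<Rightarrow> real" where "G = (\<lambda>f. (\<Prod>i\<in>UNIV. A $ i $ f i) * det (\<chi> a b. B $ f a $ b))"
  let ?inj = "{f :: 'n \<Rightarrow> 'k. inj f}"
  let ?Is = "{I :: 'k set. card I = CARD('n)}"
  let ?P = "{p :: 'n \<Rightarrow> 'n. p permutes UNIV}"
  have "det (A ** B) = (\<Sum>p\<in>?P. of_int (sign p) * (\<Prod>i\<in>UNIV. \<Sum>k\<in>UNIV. A $ i $ k * B $ k $ p i))"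
    unfolding det_def matrix_matrix_mult_def by simp
  also have "\<dots> = (\<Sum>p\<in>?P. of_int (sign p) * (\<Sum>f\<in>UNIV. \<Prod>i\<in>UNIV. A $ i $ f i * B $ f i $ p i))"
    by (subst prod_sum_PiE) (auto simp: PiE_UNIV_domain)
  also have "\<dots> = (\<Sum>p\<in>?P. \<Sum>f\<in>UNIV. (\<Prod>i\<in>UNIV. A $ i $ f i) * (of_int (sign p) * (\<Prod>i\<in>UNIV. B $ f i $ p i)))"
    by (simp add: sum_distrib_left prod.distrib mult_ac)
  also have "\<dots> = (\<Sum>f\<in>UNIV. G f)"
    unfolding G_def det_def by (subst sum.swap) (simp add: sum_distrib_left)
  also have "\<dots> = (\<Sum>f\<in>?inj. G f)"
  proof (rule sum.mono_neutral_right)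
    show "\<forall>f\<in>UNIV - ?inj. G f = 0"
    proof
    fix f :: "'n \<Rightarrow> 'k" assume "f \<in> UNIV - ?inj"
    then obtain i j where "i \<noteq> j" "f i = f j" by (auto simp: inj_def)
    then have "det (\<chi> a b. B $ f a $ b) = 0"
      by (intro det_identical_rows[of i j]) (auto simp: row_def)
    then show "G f = 0" by (simp add: G_def)
    qed
  qed auto
  also have "\<dots> = (\<Sum>I\<in>?Is. \<Sum>f\<in>{f\<in>?inj. range f = I}. G f)"
    by (rule sum.group[symmetric]) (auto simp: card_image)
  also have "\<dots> = (\<Sum>I\<in>?Is. det (\<chi> a b. A $ a $ enum_subset I b) * det (\<chi> a b. B $ enum_subset I a $ b))"
  proof (rule sum.cong[OF refl])
    fix I :: "'k set" assume I: "I \<in> ?Is"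
    define e :: "'n \<Rightarrow> 'k" where "e = enum_subset I"
    have "\<exists>e :: 'n \<Rightarrow> 'k. bij_betw e UNIV I"
      using I by (intro finite_same_card_bij) auto
    then have e: "bij_betw e UNIV I"
      unfolding e_def enum_subset_def by (rule someI_ex)
    have "(\<Sum>f\<in>{f\<in>?inj. range f = I}. G f) = (\<Sum>q\<in>?P. G (e \<circ> q))"
    proof (rule sum.reindex_bij_witness[of _ "\<lambda>q. e \<circ> q" "\<lambda>f. inv_into UNIV e \<circ> f"])
      fix f assume f: "f \<in> {f\<in>?inj. range f = I}"
      have ee: "e (inv e (f x)) = f x" for x
        using f e by (intro f_inv_into_f) (auto simp: bij_betw_def)
      show "e \<circ> (inv e \<circ> f) = f" using ee by auto
      have "inj (inv e \<circ> f)"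
        using f ee by (auto simp: inj_def) metis
      then show "inv e \<circ> f \<in> ?P"
        using finite_UNIV_inj_surj[OF finite, of "inv e \<circ> f"]
        by (auto intro!: bij_imp_permutes simp del: o_apply simp: bij_def)
      show "G (e \<circ> (inv e \<circ> f)) = G f" using ee by (auto simp: comp_def)
    next
      fix q assume q: "q \<in> ?P"
      then have "bij q" by (auto intro: permutes_bij)
      show "inv e \<circ> (e \<circ> q) = q" using e by (auto simp: bij_betw_def)
      show "e \<circ> q \<in> {f\<in>?inj. range f = I}"
        using bij_betw_trans[OF \<open>bij q\<close> e] by (simp add: bij_betw_def)
    qed
    also have "\<dots> = (\<Sum>q\<in>?P. (of_int (sign q) * (\<Prod>i\<in>UNIV. A $ i $ e (q i))) * det (\<chi> a b. B $ e a $ b))"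
    proof (rule sum.cong[OF refl])
      fix q assume "q \<in> ?P"
      then have "det (\<chi> a. (\<chi> a b. B $ e a $ b) $ q a) = of_int (sign q) * (det (\<chi> a b. B $ e a $ b) :: real)"
        by (intro det_permute_rows) auto
      then show "G (e \<circ> q) = (of_int (sign q) * (\<Prod>i\<in>UNIV. A $ i $ e (q i))) * det (\<chi> a b. B $ e a $ b)"
        by (simp add: G_def)
    qed
    also have "\<dots> = det (\<chi> a b. A $ a $ e b) * det (\<chi> a b. B $ e a $ b)"
      by (simp add: det_def[of "\<chi> a b. A $ a $ e b"] sum_distrib_right)
    finally show "(\<Sum>f\<in>{f\<in>?inj. range f = I}. G f) = det (\<chi> a b. A $ a $ enum_subset I b) * det (\<chi> a b. B $ enum_subset I a $ b)"
      by (simp add: e_def)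
  qed
  finally show ?thesis .
qed

lemma cox_map_has_derivative:
  fixes V :: "int^'k^'n"
  assumes "x \<in> pos_orthant"
  shows "(cox_map V has_derivative
     (\<lambda>\<xi>. \<chi> j. cox_map V x $ j * (\<Sum>i\<in>UNIV. real_of_int (V $ j $ i) * (\<xi> $ i / x $ i)))) (at x)"
proof -
  have x: "x $ i \<noteq> 0" for i using assms by (simp add: pos_orthant_def less_imp_neq[symmetric])
  have "((\<lambda>x. \<Prod>i\<in>UNIV. x $ i powi (V $ j $ i)) has_derivative
     (\<lambda>\<xi>. cox_map V x $ j * (\<Sum>i\<in>UNIV. real_of_int (V $ j $ i) * (\<xi> $ i / x $ i)))) (at x)" for j
  proof (rule has_derivative_eq_rhs)
    show "((\<lambda>x. \<Prod>i\<in>UNIV. x $ i powi (V $ j $ i)) has_derivative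
      (\<lambda>\<xi>. \<Sum>i\<in>UNIV. \<xi> $ i * (of_int (V $ j $ i) * (x $ i powi (V $ j $ i - 1))) *
         (\<Prod>l\<in>UNIV - {i}. x $ l powi (V $ j $ l)))) (at x)"
      by (intro has_derivative_prod has_derivative_power_int x bounded_linear_imp_has_derivative bounded_linear_vec_nth)
    show "(\<lambda>\<xi>. \<Sum>i\<in>UNIV. \<xi> $ i * (of_int (V $ j $ i) * (x $ i powi (V $ j $ i - 1))) *
         (\<Prod>l\<in>UNIV - {i}. x $ l powi (V $ j $ l))) =
      (\<lambda>\<xi>. cox_map V x $ j * (\<Sum>i\<in>UNIV. real_of_int (V $ j $ i) * (\<xi> $ i / x $ i)))"
      unfolding sum_distrib_left
    proof (intro ext sum.cong refl)
      fix \<xi> i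
      have "cox_map V x $ j = x $ i powi (V $ j $ i) * (\<Prod>l\<in>UNIV - {i}. x $ l powi (V $ j $ l))"
        by (simp add: cox_map_def prod.remove)
      then show "\<xi> $ i * (of_int (V $ j $ i) * (x $ i powi (V $ j $ i - 1))) * (\<Prod>l\<in>UNIV - {i}. x $ l powi (V $ j $ l))
        = cox_map V x $ j * (real_of_int (V $ j $ i) * (\<xi> $ i / x $ i))"
        using x by (simp add: power_int_diff)
    qed
  qed
  then have "((\<lambda>y. cox_map V y $ j) has_derivative
     (\<lambda>\<xi>. cox_map V x $ j * (\<Sum>i\<in>UNIV. real_of_int (V $ j $ i) * (\<xi> $ i / x $ i)))) (at x)" for j
    by (simp add: cox_map_def)
  then have "((\<lambda>y. \<Sum>j\<in>UNIV. (cox_map V y $ j) *\<^sub>R axis j (1::real)) has_derivative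
     (\<lambda>\<xi>. \<Sum>j\<in>UNIV. (cox_map V x $ j * (\<Sum>i\<in>UNIV. real_of_int (V $ j $ i) * (\<xi> $ i / x $ i))) *\<^sub>R axis j 1)) (at x)"
    by (intro has_derivative_sum has_derivative_scaleR_left)
  moreover have "(\<Sum>j\<in>UNIV. c j *\<^sub>R axis j (1::real)) = (\<chi> j. c j)" for c :: "'n \<Rightarrow> real"
    by (simp add: vec_eq_iff axis_def if_distrib cong: if_cong)
  ultimately show ?thesis by (simp only: vec_nth_inverse vec_lambda_eta)
qed

lemma cox_map_pos: "x \<in> pos_orthant \<Longrightarrow> 0 < cox_map V x $ j"
  by (auto simp: cox_map_def pos_orthant_def intro!: prod_pos)

text \<open>On the positive orthant, the Cox form is the pullback of \<open>\<And>\<^bsub>j\<^esub> dt\<^sub>j / t\<^sub>j\<close> under the Cox map.\<close>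

lemma cox_form_eq_pullback:
  fixes V :: "int^'k^'n"
  assumes x: "x \<in> pos_orthant"
  shows "cox_form V x \<xi> =
    det (\<chi> b. frechet_derivative (cox_map V) (at x) (\<xi> $ b)) / (\<Prod>j\<in>UNIV. cox_map V x $ j)"
proof -
  let ?B = "\<chi> i b. \<xi> $ b $ i / x $ i"
  have *: "frechet_derivative (cox_map V) (at x) v $ j =
     cox_map V x $ j * (\<Sum>i\<in>UNIV. real_of_int (V $ j $ i) * (v $ i / x $ i))" for v j
    by (subst frechet_derivative_at[OF cox_map_has_derivative[OF x], symmetric]) simp
  have "transpose (\<chi> b. frechet_derivative (cox_map V) (at x) (\<xi> $ b)) =
     (\<chi> j. cox_map V x $ j *s (real_mat V ** ?B) $ j)"
    by (simp add: vec_eq_iff transpose_def * matrix_matrix_mult_def real_mat_def)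
  then have "det (transpose (\<chi> b. frechet_derivative (cox_map V) (at x) (\<xi> $ b))) =
      (\<Prod>j\<in>UNIV. cox_map V x $ j) * det (real_mat V ** ?B)"
    by (simp only: det_rows_mul vec_lambda_eta)
  then have "det (\<chi> b. frechet_derivative (cox_map V) (at x) (\<xi> $ b)) =
      (\<Prod>j\<in>UNIV. cox_map V x $ j) * det (real_mat V ** ?B)"
    by (simp only: det_transpose)
  moreover have "(\<Prod>j\<in>UNIV. cox_map V x $ j) \<noteq> 0"
    using cox_map_pos[OF x, of V] by (simp add: less_imp_neq[symmetric])
  moreover have "det (real_mat V ** ?B) = cox_form V x \<xi>"
    unfolding cauchy_binet_sum cox_form_def Let_def
  proof (intro sum.cong refl arg_cong2[where f = "(*)"])
    fix I :: "'k set" assume I: "I \<in> {I. card I = CARD('n)}"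
    define e :: "'n \<Rightarrow> 'k" where "e = enum_subset I"
    have "\<exists>e :: 'n \<Rightarrow> 'k. bij_betw e UNIV I"
      using I by (intro finite_same_card_bij) auto
    then have e: "bij_betw e UNIV I"
      unfolding e_def enum_subset_def by (rule someI_ex)
    have "(\<chi> a b. ?B $ e a $ b) = (\<chi> a. (1 / x $ e a) *s (\<chi> b. \<xi> $ b $ e a))"
      by (simp add: vec_eq_iff)
    then have "det (\<chi> a b. ?B $ e a $ b) = (\<Prod>a\<in>UNIV. 1 / x $ e a) * det (\<chi> a b. \<xi> $ b $ e a)"
      by (simp only: det_rows_mul)
    also have "(\<Prod>a\<in>UNIV. 1 / x $ e a) = 1 / (\<Prod>i\<in>I. x $ i)"
      using prod.reindex_bij_betw[OF e, of "\<lambda>i. x $ i"] by (simp add: prod_dividef)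
    finally show "det (\<chi> a b. ?B $ enum_subset I a $ b) =
        det (\<chi> a b. \<xi> $ b $ enum_subset I a) / (\<Prod>i\<in>I. x $ i)"
      by (simp add: e_def)
  qed
  ultimately show ?thesis by simp
qed

text \<open>The hypothesis that \<open>V\<close> has rank \<open>n\<close> holds for the ray matrix of a complete fan.\<close>

lemma canonical_form_eq:
  fixes V :: "int^'k^'n"
  assumes V: "surj ((*v) (real_mat V))" and t: "t \<in> pos_orthant"
  shows "canonical_form V t \<eta> = det \<eta> / (\<Prod>j\<in>UNIV. t $ j)"
proof -
  have t': "t $ j > 0" for j using t by (simp add: pos_orthant_def)
  obtain y where y: "real_mat V *v y = (\<chi> j. ln (t $ j))" using V by (metis surjD)
  define x where "x = (\<chi> i. exp (y $ i))"
  have x: "x \<in> pos_orthant" by (simp add: x_def pos_orthant_def)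
  have "cox_map V x $ j = exp ((real_mat V *v y) $ j)" for j
    by (simp add: cox_map_def x_def exp_power_int exp_sum matrix_vector_mult_def real_mat_def)
  then have xt: "cox_map V x = t"
    using t' by (simp add: y vec_eq_iff)
  have "\<exists>z. real_mat V *v z = (\<chi> j. \<eta> $ b $ j / t $ j)" for b using V by (metis surjD)
  then obtain z where z: "real_mat V *v z b = (\<chi> j. \<eta> $ b $ j / t $ j)" for b by metis
  define \<xi> :: "(real^'k)^'n" where "\<xi> = (\<chi> b i. x $ i * z b $ i)"
  have x': "x $ i \<noteq> 0" for i by (simp add: x_def)
  have "(\<Sum>i\<in>UNIV. real_of_int (V $ j $ i) * z b $ i) = \<eta> $ b $ j / t $ j" for b j
    using arg_cong[OF z[of b], of "\<lambda>v. v $ j"] by (simp add: matrix_vector_mult_def real_mat_def)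
  then have \<xi>: "frechet_derivative (cox_map V) (at x) (\<xi> $ b) = \<eta> $ b" for b
    using t'
    by (subst frechet_derivative_at[OF cox_map_has_derivative[OF x], symmetric])
       (simp add: vec_eq_iff \<xi>_def x' xt less_imp_neq[symmetric])
  have eq: "cox_form V x' \<xi>' = det \<eta> / (\<Prod>j\<in>UNIV. t $ j)"
    if "x' \<in> pos_orthant" "cox_map V x' = t"
      "\<forall>b. frechet_derivative (cox_map V) (at x') (\<xi>' $ b) = \<eta> $ b" for x' \<xi>'
    using cox_form_eq_pullback[OF that(1), of V \<xi>'] that by simp
  show ?thesis
    unfolding canonical_form_def
  proof (rule the_equality)
    show "\<forall>x\<in>pos_orthant. \<forall>\<xi>. cox_map V x = t \<and>
        (\<forall>b. frechet_derivative (cox_map V) (at x) (\<xi> $ b) = \<eta> $ b) \<longrightarrow>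
        cox_form V x \<xi> = det \<eta> / (\<Prod>j\<in>UNIV. t $ j)"
      using eq by blast
    fix c
    assume "\<forall>x\<in>pos_orthant. \<forall>\<xi>. cox_map V x = t \<and>
        (\<forall>b. frechet_derivative (cox_map V) (at x) (\<xi> $ b) = \<eta> $ b) \<longrightarrow> cox_form V x \<xi> = c"
    then show "c = det \<eta> / (\<Prod>j\<in>UNIV. t $ j)"
      using x xt \<xi> eq by metis
  qed
qed

lemma cox_map_diff:
  fixes V :: "int^'k^'n"
  assumes "x \<in> pos_orthant" "int_exponent m - int_exponent l = transpose V *v u"
  shows "(\<Prod>i\<in>UNIV. x $ i ^ Poly_Mapping.lookup m i) =
    (\<Prod>i\<in>UNIV. x $ i ^ Poly_Mapping.lookup l i) * (\<Prod>j\<in>UNIV. cox_map V x $ j powi (u $ j))"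
proof -
  have pw: "(\<Prod>i\<in>A. h i) powi n = (\<Prod>i\<in>A. h i powi n)" for A and h :: "'k \<Rightarrow> real" and n
    by (induction A rule: infinite_finite_induct) (auto simp: power_int_mult_distrib)
  have x: "x $ i > 0" for i using assms by (simp add: pos_orthant_def)
  have "int (Poly_Mapping.lookup m i) = int (Poly_Mapping.lookup l i) + (\<Sum>j\<in>UNIV. V $ j $ i * u $ j)" for i
    using arg_cong[OF assms(2), of "\<lambda>v. v $ i"]
    by (simp add: int_exponent_def matrix_vector_mult_def transpose_def)
  moreover have "x $ i powi (\<Sum>j\<in>UNIV. V $ j $ i * u $ j) = (\<Prod>j\<in>UNIV. x $ i powi (V $ j $ i * u $ j))" for i
  proof -
    have "x $ i powi (\<Sum>j\<in>A. V $ j $ i * u $ j) = (\<Prod>j\<in>A. x $ i powi (V $ j $ i * u $ j))" for A :: "'n set"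
      by (induction A rule: infinite_finite_induct) (use x[of i] in \<open>auto simp: power_int_add\<close>)
    then show ?thesis by blast
  qed
  ultimately have "x $ i ^ Poly_Mapping.lookup m i =
      x $ i ^ Poly_Mapping.lookup l i * (\<Prod>j\<in>UNIV. x $ i powi (V $ j $ i * u $ j))" for i
    using x[of i] by (simp only: power_int_of_nat[symmetric] power_int_add less_imp_neq[symmetric] simp_thms)
  then have "(\<Prod>i\<in>UNIV. x $ i ^ Poly_Mapping.lookup m i) =
    (\<Prod>i\<in>UNIV. x $ i ^ Poly_Mapping.lookup l i) * (\<Prod>i\<in>UNIV. \<Prod>j\<in>UNIV. x $ i powi (V $ j $ i * u $ j))"
    by (simp add: prod.distrib)
  also have "(\<Prod>i\<in>UNIV. \<Prod>j\<in>UNIV. x $ i powi (V $ j $ i * u $ j)) = (\<Prod>j\<in>UNIV. cox_map V x $ j powi (u $ j))"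
    by (subst prod.swap) (simp add: cox_map_def pw power_int_mult)
  finally show ?thesis .
qed

text \<open>For homogeneous polynomials of the same degree, the tropical quotient is constant on the fibres
  of the Cox map, hence descends to the positive part.\<close>

lemma trop_fibre:
  fixes V :: "int^'k^'n" and l :: "'k \<Rightarrow>\<^sub>0 nat"
  assumes f: "f \<noteq> 0" "homogeneous V (class_rel V `` {int_exponent l}) f"
  shows "\<exists>c. \<forall>x\<in>pos_orthant. cox_map V x = t \<longrightarrow>
    trop f x = (\<Prod>i\<in>UNIV. x $ i ^ Poly_Mapping.lookup l i) * c"
proof -
  let ?m = "\<lambda>l x. \<Prod>i\<in>UNIV. x $ i ^ Poly_Mapping.lookup l i"
  have "\<exists>u. int_exponent m - int_exponent l = transpose V *v u" if "m \<in> Poly_Mapping.keys f" for m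
  proof -
    have "class_rel V `` {int_exponent m} = class_rel V `` {int_exponent l}"
      using that f by (simp add: homogeneous_def)
    moreover have "int_exponent m \<in> class_rel V `` {int_exponent m}"
      by (auto simp: class_rel_def intro!: exI[of _ 0])
    ultimately show ?thesis by (auto simp: class_rel_def)
  qed
  then obtain u where u: "int_exponent m - int_exponent l = transpose V *v u m"
    if "m \<in> Poly_Mapping.keys f" for m by metis
  define c where "c = Max ((\<lambda>m. \<Prod>j\<in>UNIV. t $ j powi (u m $ j)) ` Poly_Mapping.keys f)"
  have "trop f x = ?m l x * c" if x: "x \<in> pos_orthant" "cox_map V x = t" for x
  proof -
    have "mono ((*) (?m l x))"
      using x by (intro monoI mult_left_mono prod_nonneg) (auto simp: pos_orthant_def less_imp_le)
    then have "?m l x * c = Max ((*) (?m l x) ` (\<lambda>m. \<Prod>j\<in>UNIV. t $ j powi (u m $ j)) ` Poly_Mapping.keys f)"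
      unfolding c_def using f by (intro mono_Max_commute) auto
    also have "\<dots> = trop f x"
      unfolding trop_def image_image
      using cox_map_diff[OF x(1) u] x(2) by (intro arg_cong[where f = Max] image_cong) auto
    finally show ?thesis by simp
  qed
  then show ?thesis by blast
qed

lemma trop_quotient_descends:
  fixes V :: "int^'k^'n"
  assumes f: "f \<noteq> 0" "homogeneous V d f" and g: "g \<noteq> 0" "homogeneous V d g"
    and x: "x \<in> pos_orthant"
  shows "descend_fun V (\<lambda>x. trop f x / trop g x) (cox_map V x) = trop f x / trop g x"
proof -
  obtain l where "l \<in> Poly_Mapping.keys g" using g(1) by (metis ex_in_conv keys_eq_empty)
  then have d: "d = class_rel V `` {int_exponent l}" using g(2) by (simp add: homogeneous_def)
  let ?m = "\<lambda>x. \<Prod>i\<in>UNIV. x $ i ^ Poly_Mapping.lookup l i"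
  obtain a b where ab: "\<And>y. y \<in> pos_orthant \<Longrightarrow> cox_map V y = cox_map V x \<Longrightarrow> trop f y = ?m y * a \<and> trop g y = ?m y * b"
    using trop_fibre[OF f[unfolded d]] trop_fibre[OF g[unfolded d]] by metis
  have m: "?m y \<noteq> 0" if "y \<in> pos_orthant" for y
    using that by (auto simp: pos_orthant_def less_imp_neq[symmetric])
  have "trop f y / trop g y = a / b" if "y \<in> pos_orthant" "cox_map V y = cox_map V x" for y
    using ab[OF that] mult_divide_mult_cancel_left[OF m[OF that(1)]] by (simp only:)
  then show ?thesis unfolding descend_fun_def using x by (intro the_equality) auto
qed

end

theory Submission
  imports Defs
begin

text \<open>
  In logarithmic coordinates the theorem is the integral of the exponential of a linear form over a
  simplicial cone. The Cox map turns \<open>Exp\<close> into \<open>y \<mapsto> exp (V y)\<close>, taken coordinatewise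
  (\<open>Exp_map_eq\<close>), so it kills the lineality space \<open>K\<close>. Writing a point of \<open>\<sigma>\<close> modulo \<open>K\<close> as
  \<open>W c\<close> with \<open>c \<ge> 0\<close> therefore parametrizes \<open>Exp \<sigma>\<close> by \<open>c \<mapsto> exp (M c)\<close>, where
  \<open>M = V W\<close> is a square matrix with positive determinant.

  Three facts make the integral explicit. On \<open>\<sigma>\<close> the maximum defining a tropical polynomial is
  attained at the chosen vertex, so the integrand at \<open>Exp y\<close> is \<open>exp (- y \<bullet> \<delta>)\<close>
  (\<open>face_of_cone_maximizes\<close>, \<open>trop_exp\<close>). The canonical form is \<open>dt / (t\<^sub>1 \<cdots> t\<^sub>n)\<close>, whose
  denominator cancels the Jacobian of the exponential and leaves the factor \<open>det M\<close>. Finally the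
  integral of \<open>exp (- a \<bullet> c)\<close> over the orthant factors into one-dimensional integrals
  \<open>1 / a\<^sub>l\<close>, with \<open>a\<^sub>l = w\<^sub>l \<bullet> \<delta>\<close> (\<open>exp_cone_integral\<close>).

  Convergence needs \<open>w\<^sub>l \<bullet> \<delta> > 0\<close> (\<open>interior_value_less_max\<close>). The point \<open>\<nu>\<^sub>f\<close> is a relative interior
  point of \<open>N(g)\<close>, so if \<open>w\<^sub>l\<close> were maximal there over \<open>N(g)\<close>, it would be constant on \<open>N(g)\<close>.
  Homogeneity puts all differences of points of \<open>N(g)\<close> into the row space of \<open>V\<close>, and by dimension
  they span it. Then \<open>w\<^sub>l\<close> would lie in \<open>K\<close>, contradicting that \<open>M\<close> is invertible.
\<close>

section \<open>Reindexing coordinates\<close>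

text \<open>The change-of-variables theorem \<open>has_absolute_integral_change_of_variables\<close> speaks about vectors
  indexed by a well-ordered finite type. This copy of an initial segment of \<open>\<nat>\<close> has as many elements
  as \<^typ>\<open>'a\<close> and a well-order, so the theorem carries over to an arbitrary finite index type by
  renaming coordinates.\<close>

typedef ('a::finite) enum_index = "{..<CARD('a)}"
  by (rule exI[of _ 0]) simp

instantiation enum_index :: (finite) linorder
begin
definition "x \<le> y \<longleftrightarrow> Rep_enum_index x \<le> Rep_enum_index y"
definition "x < y \<longleftrightarrow> Rep_enum_index x < Rep_enum_index y"
instance
  by standard (auto simp: less_eq_enum_index_def less_enum_index_def Rep_enum_index_inject)
end

instance enum_index :: (finite) wellorder
proof
  fix P :: "'a enum_index \<Rightarrow> bool" and a
  assume "\<And>x. (\<And>y. y < x \<Longrightarrow> P y) \<Longrightarrow> P x"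
  then show "P a"
    unfolding less_enum_index_def by (rule measure_induct_rule)
qed

instance enum_index :: (finite) finite
proof
  show "finite (UNIV :: 'a enum_index set)"
    unfolding type_definition.univ[OF type_definition_enum_index] by simp
qed

lemma CARD_enum_index: "CARD('a::finite enum_index) = CARD('a)"
  using type_definition.card[OF type_definition_enum_index[where 'a='a]] by simp

lemma bij_enum_index:
  obtains p :: "'a::finite enum_index \<Rightarrow> 'a" where "bij p"
  using finite_same_card_bij[OF finite finite CARD_enum_index[where 'a='a]] by blast

text \<open>Conjugation by a bijection between two types turns a product of transpositions into a product of
  equally many transpositions. Hence it preserves the sign, and the Leibniz formula shows that
  renaming the row and column indices by the same bijection does not change a determinant.\<close>

lemma swapidseq_conj:
  assumes "bij f" "swapidseq n p"
  shows "swapidseq n (f \<circ> p \<circ> inv f)"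
  using assms(2)
proof induction
  case id
  have "f \<circ> id \<circ> inv f = id"
    using assms(1) by (simp add: fun_eq_iff bij_is_surj surj_f_inv_f)
  then show ?case by (simp only: swapidseq.id)
next
  case (comp_Suc n p a b)
  have "f \<circ> (Transposition.transpose a b \<circ> p) \<circ> inv f = Transposition.transpose (f a) (f b) \<circ> (f \<circ> p \<circ> inv f)"
    using assms(1) by (auto simp: fun_eq_iff Transposition.transpose_def bij_is_inj inj_eq)
  then show ?case
    using comp_Suc assms(1) by (metis bij_is_inj inj_eq swapidseq.comp_Suc)
qed

lemma sign_conj:
  fixes f :: "'a::finite \<Rightarrow> 'b::finite"
  assumes f: "bij f" and p: "p permutes UNIV"
  shows "sign (f \<circ> p \<circ> inv f) = sign p"
proof -
  have "permutation p"
    using p permutation_permutes finite by metis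
  then obtain n where n: "swapidseq n p"
    unfolding permutation_def by auto
  show ?thesis
    using evenperm_unique[OF n refl] evenperm_unique[OF swapidseq_conj[OF f n] refl]
    by (simp add: sign_def)
qed

lemma det_reindex:
  fixes A :: "'c::comm_ring_1^'n^'n" and p :: "'m::finite \<Rightarrow> 'n"
  assumes p: "bij p"
  shows "det (\<chi> i j. A $ p i $ p j) = det A"
proof -
  have pinv: "inv p (p x) = x" "p (inv p y) = y" for x y
    using p by (simp_all add: bij_is_inj bij_is_surj surj_f_inv_f)
  show ?thesis
    unfolding det_def
  proof (rule sum.reindex_bij_witness[where j = "\<lambda>r. p \<circ> r \<circ> inv p" and i = "\<lambda>s. inv p \<circ> s \<circ> p"])
    fix r :: "'m \<Rightarrow> 'm" assume "r \<in> {r. r permutes UNIV}"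
    then have r: "r permutes UNIV" by simp
    show "inv p \<circ> (p \<circ> r \<circ> inv p) \<circ> p = r" by (simp add: fun_eq_iff pinv)
    have "bij (p \<circ> r \<circ> inv p)"
      using p r by (intro bij_comp bij_imp_bij_inv permutes_bij)
    then show "p \<circ> r \<circ> inv p \<in> {s. s permutes UNIV}"
      by (auto intro: bij_imp_permutes)
    have "(\<Prod>i\<in>UNIV. A $ i $ p (r (inv p i))) = (\<Prod>i\<in>UNIV. A $ p i $ p (r i))"
      using prod.reindex_bij_betw[OF p, of "\<lambda>i. A $ i $ p (r (inv p i))"] by (simp add: pinv)
    then show "of_int (sign (p \<circ> r \<circ> inv p)) * (\<Prod>i\<in>UNIV. A $ i $ (p \<circ> r \<circ> inv p) i) =
        of_int (sign r) * (\<Prod>i\<in>UNIV. (\<chi> i j. A $ p i $ p j) $ i $ r i)"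
      by (simp add: sign_conj[OF p r])
  next
    fix s :: "'n \<Rightarrow> 'n" assume "s \<in> {s. s permutes UNIV}"
    then have s: "s permutes UNIV" by simp
    show "p \<circ> (inv p \<circ> s \<circ> p) \<circ> inv p = s" by (simp add: fun_eq_iff pinv)
    have "bij (inv p \<circ> s \<circ> p)"
      using p s by (intro bij_comp bij_imp_bij_inv permutes_bij)
    then show "inv p \<circ> s \<circ> p \<in> {r. r permutes UNIV}"
      by (auto intro: bij_imp_permutes)
  qed
qed

definition reindex :: "('m \<Rightarrow> 'n) \<Rightarrow> real^'n \<Rightarrow> real^'m" where
  "reindex p x = (\<chi> i. x $ p i)"

lemma linear_reindex: "linear (reindex p)"
  by (rule linearI) (simp_all add: reindex_def vec_eq_iff)

lemma continuous_on_reindex: "continuous_on S (reindex p)"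
  by (simp add: linear_continuous_on linear_linear linear_reindex)

lemma borel_measurable_reindex [measurable]: "reindex p \<in> borel_measurable borel"
  by (intro borel_measurable_continuous_onI continuous_on_reindex)

lemma prod_Basis_vec:
  "(\<Prod>b\<in>Basis. h b) = (\<Prod>i\<in>UNIV. h (axis i 1))" for h :: "real^'n \<Rightarrow> 'b::comm_monoid_mult"
proof -
  have B: "(Basis :: (real^'n) set) = range (\<lambda>i. axis i 1)"
    by (auto simp: Basis_vec_def)
  have "inj (\<lambda>i::'n. axis i (1::real))"
    by (simp add: inj_on_def axis_eq_axis)
  then show ?thesis
    unfolding B by (subst prod.reindex) (simp_all add: o_def)
qed

lemma reindex_inverse:
  assumes "bij p"
  shows "reindex (inv p) (reindex p x) = x" "reindex p (reindex (inv p) y) = y"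
  using assms by (simp_all add: reindex_def vec_eq_iff bij_is_inj bij_is_surj surj_f_inv_f)

lemma image_reindex_eq_vimage:
  assumes p: "bij p"
  shows "reindex p ` S = reindex (inv p) -` S"
proof (intro set_eqI iffI)
  fix y assume "y \<in> reindex (inv p) -` S"
  then show "y \<in> reindex p ` S"
    by (intro image_eqI[of _ _ "reindex (inv p) y"]) (simp_all add: reindex_inverse[OF p])
qed (auto simp: reindex_inverse[OF p])

text \<open>A renaming of coordinates maps boxes to boxes with the same side lengths.\<close>

lemma lborel_distr_reindex:
  fixes p :: "'m::finite \<Rightarrow> 'n::finite"
  assumes p: "bij p"
  shows "distr lborel borel (reindex p) = lborel"
proof (rule lborel_eqI[symmetric])
  fix l u :: "real^'m"
  assume le: "\<And>b. b \<in> Basis \<Longrightarrow> l \<bullet> b \<le> u \<bullet> b"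
  have lu: "l $ i \<le> u $ i" for i using le[of "axis i 1"] by (simp add: inner_axis)
  have vim: "reindex p -` box l u = box (reindex (inv p) l) (reindex (inv p) u)"
    using p by (auto simp: mem_box_cart reindex_def bij_is_inj bij_is_surj surj_f_inv_f)
      (metis bij_inv_eq_iff)+
  have le': "reindex (inv p) l \<bullet> b \<le> reindex (inv p) u \<bullet> b" if "b \<in> Basis" for b
    using that lu by (auto simp: Basis_vec_def inner_axis reindex_def)
  have "emeasure (distr lborel borel (reindex p)) (box l u) =
      emeasure lborel (box (reindex (inv p) l) (reindex (inv p) u))"
    by (simp add: emeasure_distr vim)
  also have "\<dots> = ennreal (\<Prod>j\<in>UNIV. u $ inv p j - l $ inv p j)"
    using le' by (simp add: prod_Basis_vec inner_axis reindex_def)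
  also have "(\<Prod>j\<in>UNIV. u $ inv p j - l $ inv p j) = (\<Prod>b\<in>Basis. (u - l) \<bullet> b)"
    using prod.reindex_bij_betw[OF bij_imp_bij_inv[OF p], of "\<lambda>i. u $ i - l $ i"]
    by (simp add: prod_Basis_vec inner_axis)
  finally show "emeasure (distr lborel borel (reindex p)) (box l u) = (\<Prod>b\<in>Basis. (u - l) \<bullet> b)" .
qed simp

section \<open>Change of variables\<close>

text \<open>The Borel hypotheses allow integration against \<^const>\<open>lborel\<close> in place of the complete Lebesgue
  measure.\<close>

lemma lborel_change_of_variables_wellorder:
  fixes f :: "real^'n::{finite,wellorder} \<Rightarrow> real" and g :: "real^'n::_ \<Rightarrow> real^'n::_"
  assumes S: "S \<in> sets borel" and gS: "g ` S \<in> sets borel" and f: "f \<in> borel_measurable borel"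
    and der: "\<And>x. x \<in> S \<Longrightarrow> (g has_derivative g' x) (at x within S)" and inj: "inj_on g S"
    and int: "set_integrable lborel S (\<lambda>x. \<bar>det (matrix (g' x))\<bar> * f (g x))"
  shows "(LINT t:g ` S|lborel. f t) = (LINT x:S|lborel. \<bar>det (matrix (g' x))\<bar> * f (g x))"
proof -
  let ?h = "\<lambda>x. \<bar>det (matrix (g' x))\<bar> *\<^sub>R f (g x)"
  have hm: "(\<lambda>x. indicat_real S x *\<^sub>R ?h x) \<in> borel_measurable lborel"
    using int by (simp add: set_integrable_def)
  have h: "?h absolutely_integrable_on S"
    using int integrable_completion[OF hm] by (simp add: set_integrable_def)
  have S': "S \<in> sets lebesgue" using S by simp
  have fm: "(\<lambda>x. indicat_real (g ` S) x *\<^sub>R f x) \<in> borel_measurable lborel"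
    using f gS by simp
  \<comment> \<open>The change-of-variables theorem is about vector-valued functions, so \<^term>\<open>f\<close> is viewed as a
    function to \<open>\<real>\<^sup>1\<close>.\<close>
  have "(\<lambda>x. \<bar>det (matrix (g' x))\<bar> *\<^sub>R vec (f (g x)) :: real^1) = (\<lambda>x. vec (?h x))"
    by (simp add: fun_eq_iff vec_eq_iff)
  then have *: "f absolutely_integrable_on (g ` S)" "integral (g ` S) f = integral S ?h"
    using has_absolute_integral_change_of_variables[OF S' der inj, of "\<lambda>x. vec (f x) :: real^1" "vec (integral S ?h)"] h
    by (simp_all add: absolutely_integrable_on_1_iff integral_on_1_eq)
  show ?thesis
    using set_lebesgue_integral_eq_integral(2)[OF *(1)] set_lebesgue_integral_eq_integral(2)[OF h] *(2)
      integral_completion[OF fm] integral_completion[OF hm]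
    by (simp add: set_lebesgue_integral_def)
qed

text \<open>Conjugating \<^term>\<open>g\<close> by a renaming of coordinates moves the statement to a well-ordered index type.
  Lebesgue measure and the Jacobian determinant are both unchanged.\<close>

lemma lborel_change_of_variables:
  fixes f :: "real^'n \<Rightarrow> real" and g :: "real^'n \<Rightarrow> real^'n"
  assumes S: "S \<in> sets borel" and gS: "g ` S \<in> sets borel" and f: "f \<in> borel_measurable borel"
    and der: "\<And>x. x \<in> S \<Longrightarrow> (g has_derivative g' x) (at x within S)" and inj: "inj_on g S"
    and int: "set_integrable lborel S (\<lambda>x. \<bar>det (matrix (g' x))\<bar> * f (g x))"
  shows "(LINT t:g ` S|lborel. f t) = (LINT x:S|lborel. \<bar>det (matrix (g' x))\<bar> * f (g x))"
proof -
  obtain p :: "'n enum_index \<Rightarrow> 'n" where p: "bij p" by (rule bij_enum_index)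
  define R where "R = reindex p"
  define R' where "R' = reindex (inv p)"
  have R: "R' (R x) = x" "R (R' y) = y" for x y
    unfolding R_def R'_def by (rule reindex_inverse[OF p])+
  have meas [measurable]: "R \<in> borel_measurable borel" "R' \<in> borel_measurable borel"
    by (simp_all add: R_def R'_def)
  have img: "R ` X = R' -` X" for X
    unfolding R_def R'_def by (rule image_reindex_eq_vimage[OF p])
  define G where "G = R \<circ> g \<circ> R'"
  define G' where "G' = (\<lambda>y. R \<circ> g' (R' y) \<circ> R')"
  have mat: "det (matrix (G' y)) = det (matrix (g' (R' y)))" for y
  proof -
    have ax: "R' (axis b 1) = axis (p b) 1" for b
      using p by (auto simp: R'_def reindex_def vec_eq_iff axis_def bij_is_inj bij_is_surj surj_f_inv_f)
    have "matrix (G' y) = (\<chi> a b. matrix (g' (R' y)) $ p a $ p b)"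
      by (simp add: ax G'_def matrix_def R_def reindex_def)
    then show ?thesis using det_reindex[OF p] by simp
  qed
  have transfer_int: "integrable lborel F \<longleftrightarrow> integrable lborel (\<lambda>x. F (R x))"
    "integral\<^sup>L lborel F = (LINT x|lborel. F (R x))" if "F \<in> borel_measurable borel"
    for F :: "real^'n enum_index \<Rightarrow> real"
  proof -
    have "R \<in> lborel \<rightarrow>\<^sub>M borel" using meas(1) by simp
    then show "integrable lborel F \<longleftrightarrow> integrable lborel (\<lambda>x. F (R x))"
      "integral\<^sup>L lborel F = (LINT x|lborel. F (R x))"
      using integrable_distr_eq[of R lborel borel F] integral_distr[of R lborel borel F] that
      unfolding lborel_distr_reindex[OF p, folded R_def] by blast+
  qed
  have ind: "indicat_real (R ` X) (R x) = indicat_real X x" for X x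
    by (simp add: img indicator_def R)
  have GRS: "G ` R ` S = R ` g ` S" by (simp add: G_def image_image R)
  let ?h = "\<lambda>x. \<bar>det (matrix (g' x))\<bar> * f (g x)"
  let ?H = "\<lambda>y. \<bar>det (matrix (G' y))\<bar> * (f \<circ> R') (G y)"
  have H: "?H y = ?h (R' y)" for y by (simp add: mat G_def R)
  have hm: "(\<lambda>x. indicat_real S x *\<^sub>R ?h x) \<in> borel_measurable borel"
    using int borel_measurable_integrable by (force simp: set_integrable_def)
  have "indicat_real (R ` S) y *\<^sub>R ?H y = indicat_real S (R' y) *\<^sub>R ?h (R' y)" for y
    unfolding H by (simp add: img indicator_def)
  then have Hm: "(\<lambda>y. indicat_real (R ` S) y *\<^sub>R ?H y) \<in> borel_measurable borel"
    using measurable_compose[OF meas(2) hm] by simp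
  have fS: "(\<lambda>y. indicat_real (R ` g ` S) y *\<^sub>R (f \<circ> R') y) \<in> borel_measurable borel"
    unfolding img using gS f by measurable
  have "(LINT t:g ` S|lborel. f t) = (LINT y:G ` R ` S|lborel. (f \<circ> R') y)"
    unfolding set_lebesgue_integral_def GRS by (subst transfer_int(2)[OF fS]) (simp add: ind R)
  also have "\<dots> = (LINT y:R ` S|lborel. ?H y)"
  proof (rule lborel_change_of_variables_wellorder)
    show "R ` S \<in> sets borel" "G ` R ` S \<in> sets borel"
      unfolding GRS unfolding img using S gS measurable_sets_borel[OF meas(2)] by auto
    show "f \<circ> R' \<in> borel_measurable borel" using f by measurable
    show "inj_on G (R ` S)" using inj by (auto simp: inj_on_def G_def R) (metis R(1))
    show "set_integrable lborel (R ` S) ?H"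
      using int unfolding set_integrable_def unfolding transfer_int(1)[OF Hm] unfolding ind H R .
    fix y assume "y \<in> R ` S"
    then have y: "R' y \<in> S" by (auto simp: R)
    have im: "R' ` R ` S = S" by (simp add: image_image R)
    have dR: "(R has_derivative R) F" "(R' has_derivative R') F'" for F F'
      unfolding R_def R'_def by (simp_all add: linear_imp_has_derivative linear_reindex)
    have "(g \<circ> R' has_derivative g' (R' y) \<circ> R') (at y within R ` S)"
      by (rule diff_chain_within[OF dR(2)]) (simp only: im der[OF y])
    then have "(R \<circ> (g \<circ> R') has_derivative R \<circ> (g' (R' y) \<circ> R')) (at y within R ` S)"
      by (rule diff_chain_within[OF _ dR(1)])
    then show "(G has_derivative G' y) (at y within R ` S)"
      by (simp only: G_def G'_def comp_assoc)
  qed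
  also have "\<dots> = (LINT x:S|lborel. ?h x)"
    unfolding set_lebesgue_integral_def unfolding transfer_int(2)[OF Hm] unfolding ind H R ..
  finally show ?thesis .
qed

section \<open>The exponential integral over a simplicial cone\<close>

text \<open>The integrand is a product of functions of one coordinate each, so Tonelli reduces the integral to
  \<open>\<integral>\<^sub>0\<^sup>\<infinity> exp (- s x) dx = 1 / s\<close>. The Bochner version also records integrability.\<close>

lemma has_bochner_integral_exp_orthant:
  fixes a :: "real^'n"
  assumes a: "\<And>l. 0 < a $ l"
  shows "has_bochner_integral lborel (\<lambda>c. indicator {c. \<forall>l. 0 \<le> c $ l} c *\<^sub>R exp (- (a \<bullet> c)))
           (1 / (\<Prod>l\<in>UNIV. a $ l))"
proof (rule has_bochner_integral_nn_integral)
  let ?O = "{c :: real^'n. \<forall>l. 0 \<le> c $ l}"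
  have "?O \<in> sets borel" 
    by (intro borel_closed closed_Collect_all closed_Collect_le continuous_intros)
  then show "(\<lambda>c. indicator ?O c *\<^sub>R exp (- (a \<bullet> c))) \<in> borel_measurable lborel"
    by simp
  show "AE c in lborel. 0 \<le> indicator ?O c *\<^sub>R exp (- (a \<bullet> c))" by simp
  show "0 \<le> 1 / (\<Prod>l\<in>UNIV. a $ l)" using a by (simp add: prod_nonneg less_imp_le)
  have one_dim: "(\<integral>\<^sup>+x. ennreal (indicator {0..} x * exp (- (s * x))) \<partial>lborel) = ennreal (1 / s)"
    if "s > 0" for s :: real
    using nn_integral_has_integral_lebesgue[OF _ has_integral_exp_minus_to_infinity[OF that, of 0]] by simp
  have "ennreal (indicator ?O c *\<^sub>R exp (- (a \<bullet> c))) =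
      (\<Prod>b\<in>Basis. ennreal (indicator {0..} (c \<bullet> b) * exp (- ((a \<bullet> b) * (c \<bullet> b)))))" for c
  proof -
    have "indicator ?O c * exp (- (a \<bullet> c)) = (\<Prod>l\<in>UNIV. indicator {0..} (c $ l) * exp (- (a $ l * c $ l)))"
      by (auto simp: inner_vec_def exp_sum sum_negf[symmetric] indicator_def split: if_splits)
    then show ?thesis by (simp add: prod_Basis_vec inner_axis prod_ennreal)
  qed
  then have "(\<integral>\<^sup>+c. ennreal (indicator ?O c *\<^sub>R exp (- (a \<bullet> c))) \<partial>lborel) =
      (\<Prod>b\<in>Basis. \<integral>\<^sup>+x. ennreal (indicator {0..} x * exp (- ((a \<bullet> b) * x))) \<partial>lborel)"
    by (simp only:) (subst nn_integral_lborel_prod; simp)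
  also have "\<dots> = ennreal (1 / (\<Prod>l\<in>UNIV. a $ l))"
    using a by (simp add: prod_Basis_vec inner_axis one_dim prod_ennreal less_imp_le prod_dividef)
  finally show "(\<integral>\<^sup>+c. ennreal (indicator ?O c *\<^sub>R exp (- (a \<bullet> c))) \<partial>lborel) =
      ennreal (1 / (\<Prod>l\<in>UNIV. a $ l))" .
qed

lemma exp_linear_has_derivative:
  fixes M :: "real^'n^'m"
  shows "((\<lambda>c. \<chi> j. exp ((M *v c) $ j)) has_derivative
     (\<lambda>v. \<chi> j. exp ((M *v c) $ j) * (M *v v) $ j)) (at c within S)"
proof -
  have lin: "bounded_linear (\<lambda>c. (M *v c) $ j)" for j
    using bounded_linear_compose[OF bounded_linear_vec_nth matrix_vector_mul_bounded_linear] .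
  have "((\<lambda>c. exp ((M *v c) $ j)) has_derivative (\<lambda>v. exp ((M *v c) $ j) * (M *v v) $ j)) (at c within S)" for j
    by (rule has_derivative_eq_rhs[OF has_derivative_exp[OF bounded_linear_imp_has_derivative[OF lin]]])
       (simp add: mult.commute)
  then show ?thesis
    by (subst has_derivative_componentwise_within)
       (auto simp: Basis_vec_def inner_axis)
qed

text \<open>In the coordinates \<open>c\<close> the Jacobian of \<open>c \<mapsto> exp (M c)\<close> is \<open>det M\<close> times the product of
  the torus coordinates, which cancels the denominator of the integrand. The hypothesis prescribes
  \<^term>\<open>h\<close> only on the image of the orthant, the domain of integration.\<close>

lemma exp_cone_integral:
  fixes M :: "real^'n^'n" and a :: "real^'n" and h :: "real^'n \<Rightarrow> real"
  defines "E \<equiv> \<lambda>c. \<chi> j. exp ((M *v c) $ j)"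
    and "C \<equiv> {c :: real^'n. \<forall>l. 0 \<le> c $ l}"
  assumes M: "det M \<noteq> 0" and a: "\<And>l. 0 < a $ l"
    and h: "\<And>c. c \<in> C \<Longrightarrow> h (E c) = exp (- (a \<bullet> c)) / (\<Prod>j\<in>UNIV. E c $ j)"
  shows "(LINT t:E ` C|lborel. h t) = \<bar>det M\<bar> / (\<Prod>l\<in>UNIV. a $ l)"
proof -
  obtain N where "M ** N = mat 1" "N ** M = mat 1"
    using M by (auto simp: invertible_det_nz[symmetric] invertible_def)
  then have N: "N *v (M *v c) = c" "M *v (N *v c) = c" for c
    by (simp_all add: matrix_vector_mul_assoc)
  \<comment> \<open>The explicit inverse shows that the image of the orthant is a Borel set and extends the integrand
    to a Borel function on the whole space.\<close>
  define L where "L = (\<lambda>t :: real^'n. N *v (\<chi> j. ln (t $ j)))"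
  have LE: "L (E c) = c" for c
    by (simp add: L_def E_def N)
  have EL: "E (L t) = t" if "\<forall>j. 0 < t $ j" for t
    using that by (simp add: L_def E_def N vec_eq_iff)
  have Epos: "0 < E c $ j" for c j by (simp add: E_def)
  have inj: "inj_on E C" using LE by (metis inj_on_inverseI)
  have img: "E ` C = {t. (\<forall>j. 0 < t $ j) \<and> (\<forall>l. 0 \<le> L t $ l)}"
  proof (intro set_eqI iffI)
    fix t assume "t \<in> {t. (\<forall>j. 0 < t $ j) \<and> (\<forall>l. 0 \<le> L t $ l)}"
    then show "t \<in> E ` C" by (intro image_eqI[of _ _ "L t"]) (simp_all add: EL C_def)
  qed (auto simp: LE Epos C_def)
  have [measurable]: "(\<lambda>t :: real^'n. t $ j) \<in> borel_measurable borel" for j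
    by (intro borel_measurable_continuous_onI continuous_intros)
  have Lj: "(\<lambda>t. L t $ l) \<in> borel_measurable borel" for l
    unfolding L_def matrix_vector_mult_def by simp
  have C: "C \<in> sets borel"
    unfolding C_def by (intro borel_closed closed_Collect_all closed_Collect_le continuous_intros)
  have EO: "E ` C \<in> sets borel"
    unfolding img using Lj by measurable
  define f where "f = (\<lambda>t. exp (- (\<Sum>l\<in>UNIV. a $ l * L t $ l)) / (\<Prod>j\<in>UNIV. t $ j))"
  have f: "f \<in> borel_measurable borel"
    unfolding f_def using Lj by measurable
  have fE: "f (E c) = exp (- (a \<bullet> c)) / (\<Prod>j\<in>UNIV. E c $ j)" for c
    by (simp add: f_def LE inner_vec_def)
  define E' where "E' = (\<lambda>c v. \<chi> j. exp ((M *v c) $ j) * (M *v v) $ j)"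
  have det: "det (matrix (E' c)) = (\<Prod>j\<in>UNIV. E c $ j) * det M" for c
  proof -
    have "matrix (E' c) = (\<chi> j. (E c $ j) *s M $ j)"
      by (simp add: E'_def E_def matrix_def vec_eq_iff matrix_vector_mult_basis column_def)
    then show ?thesis by (simp add: det_rows_mul)
  qed
  have pullback: "\<bar>det (matrix (E' c))\<bar> * f (E c) = \<bar>det M\<bar> * exp (- (a \<bullet> c))" for c
  proof -
    have "\<bar>p * det M\<bar> * (x / p) = \<bar>det M\<bar> * x" if "0 < p" for p x :: real
      using that by (simp add: abs_mult)
    moreover have "0 < (\<Prod>j\<in>UNIV. E c $ j)" using Epos by (intro prod_pos) auto
    ultimately show ?thesis unfolding det fE by blast
  qed
  note B = has_bochner_integral_exp_orthant[OF a, folded C_def]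
  have "(LINT t:E ` C|lborel. h t) = (LINT t:E ` C|lborel. f t)"
    using EO by (intro set_lebesgue_integral_cong) (auto simp: h fE)
  also have "\<dots> = (LINT c:C|lborel. \<bar>det (matrix (E' c))\<bar> * f (E c))"
  proof (rule lborel_change_of_variables[OF C EO f _ inj])
    show "(E has_derivative E' c) (at c within C)" for c
      unfolding E_def E'_def by (rule exp_linear_has_derivative)
    show "set_integrable lborel C (\<lambda>c. \<bar>det (matrix (E' c))\<bar> * f (E c))"
      unfolding pullback using integrable.intros[OF B]
      by (simp add: set_integrable_def mult.left_commute)
  qed
  also have "\<dots> = \<bar>det M\<bar> * (LINT c:C|lborel. exp (- (a \<bullet> c)))"
    unfolding pullback by simp
  also have "\<dots> = \<bar>det M\<bar> / (\<Prod>l\<in>UNIV. a $ l)"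
    using has_bochner_integral_integral_eq[OF B] by (simp add: set_lebesgue_integral_def)
  finally show ?thesis .
qed

section \<open>Relative interiors and cones\<close>

text \<open>A segment from a point of \<^term>\<open>S\<close> to a relative interior point can be prolonged slightly within
  \<^term>\<open>S\<close>. If the linear form increased along it, it would exceed its maximum.\<close>

lemma linear_attaining_max_in_rel_interior:
  fixes S :: "'a::euclidean_space set"
  assumes S: "convex S" and p: "p \<in> rel_interior S"
    and max: "\<And>q. q \<in> S \<Longrightarrow> w \<bullet> q \<le> w \<bullet> p" and q: "q \<in> S"
  shows "w \<bullet> q = w \<bullet> p"
proof -
  have "q \<in> affine hull S" using q by (rule hull_inc)
  then obtain m where m: "m > 1" "\<forall>e. e > 1 \<and> e \<le> m \<longrightarrow> (1 - e) *\<^sub>R q + e *\<^sub>R p \<in> S"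
    using convex_rel_interior_if[OF S p] by blast
  then have "w \<bullet> ((1 - m) *\<^sub>R q + m *\<^sub>R p) \<le> w \<bullet> p"
    using max by auto
  then have "(m - 1) * (w \<bullet> p - w \<bullet> q) \<le> 0"
    by (simp add: inner_simps algebra_simps)
  then have "w \<bullet> p \<le> w \<bullet> q"
    using m(1) by (simp add: mult_le_0_iff)
  then show ?thesis using max[OF q] by simp
qed

lemma convex_cone_hull_columns:
  fixes W :: "real^'n^'k"
  shows "convex_cone hull (columns W) = (*v) W ` {c. \<forall>l. 0 \<le> c $ l}"
proof (rule hull_unique)
  show "columns W \<subseteq> (*v) W ` {c. \<forall>l. 0 \<le> c $ l}"
  proof
    fix w assume "w \<in> columns W"
    then obtain l where "w = column l W" by (auto simp: columns_def)
    then show "w \<in> (*v) W ` {c. \<forall>l. 0 \<le> c $ l}"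
      by (intro image_eqI[of _ _ "axis l 1"]) (simp_all add: matrix_vector_mult_basis, simp add: axis_def)
  qed
  have "convex_cone {c :: real^'n. \<forall>l. 0 \<le> c $ l}"
    by (auto simp: convex_cone_iff)
  then show "convex_cone ((*v) W ` {c. \<forall>l. 0 \<le> c $ l})"
    by (intro convex_cone_linear_image conjI matrix_vector_mul_linear)
next
  fix T assume T: "columns W \<subseteq> T" "convex_cone T"
  show "(*v) W ` {c. \<forall>l. 0 \<le> c $ l} \<subseteq> T"
  proof clarify
    fix c :: "real^'n" assume c: "\<forall>l. 0 \<le> c $ l"
    have "(\<Sum>l\<in>A. c $ l *\<^sub>R column l W) \<in> T" if "finite A" for A
      using that
    proof (induction A)
      case empty
      then show ?case using convex_cone_contains_0[OF T(2)] by simp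
    next
      case (insert l A)
      moreover have "column l W \<in> T" using T(1) by (auto simp: columns_def)
      ultimately show ?case
        using c by (simp add: convex_cone_add convex_cone_scaleR T(2))
    qed
    then show "W *v c \<in> T"
      by (simp add: matrix_mult_sum scalar_mult_eq_scaleR)
  qed
qed

section \<open>Newton polytopes of homogeneous polynomials\<close>

definition row_space :: "int^'k^'n \<Rightarrow> (real^'k) set" where
  "row_space V = range ((*v) (transpose (real_mat V)))"

lemma subspace_row_space: "subspace (row_space V)"
  unfolding row_space_def
  by (rule linear_subspace_image[OF matrix_vector_mul_linear subspace_UNIV])

lemma dim_row_space:
  fixes V :: "int^'k^'n"
  shows "dim (row_space V) \<le> CARD('n)"
  unfolding row_space_def
  using dim_image_le[OF matrix_vector_mul_linear, of "transpose (real_mat V)" "UNIV :: (real^'n) set"] by simp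

lemma orthogonal_row_space_iff:
  "(\<forall>z\<in>row_space V. u \<bullet> z = 0) \<longleftrightarrow> u \<in> ker_mat (real_mat V)"
proof -
  have "u \<bullet> (transpose (real_mat V) *v z) = (real_mat V *v u) \<bullet> z" for z
    by (metis dot_lmul_matrix inner_commute transpose_matrix_vector)
  then show ?thesis
    by (auto simp: row_space_def ker_mat_def)
qed

text \<open>Equality of degrees in \<open>Cl(X) = \<int>\<^sup>k / im V\<^sup>T\<close> says that the exponents differ by an integral
  combination of the rows of \<open>V\<close>.\<close>

lemma homogeneous_exponent_diff:
  fixes V :: "int^'k^'n"
  assumes "homogeneous V d f" "homogeneous V d g" "m \<in> Poly_Mapping.keys f" "l \<in> Poly_Mapping.keys g"
  shows "real_exponent m - real_exponent l \<in> row_space V"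
proof -
  have "class_rel V `` {int_exponent m} = class_rel V `` {int_exponent l}"
    using assms by (simp add: homogeneous_def)
  moreover have "int_exponent m \<in> class_rel V `` {int_exponent m}"
    by (auto simp: class_rel_def intro!: exI[of _ 0])
  ultimately obtain u where u: "int_exponent m - int_exponent l = transpose V *v u"
    by (auto simp: class_rel_def)
  have "real (Poly_Mapping.lookup m i) - real (Poly_Mapping.lookup l i) = (\<Sum>j\<in>UNIV. real_of_int (V $ j $ i) * real_of_int (u $ j))" for i
  proof -
    have "int (Poly_Mapping.lookup m i) - int (Poly_Mapping.lookup l i) = (\<Sum>j\<in>UNIV. V $ j $ i * u $ j)"
      using arg_cong[OF u, of "\<lambda>v. v $ i"]
      by (simp add: int_exponent_def matrix_vector_mult_def transpose_def)
    from arg_cong[OF this, of real_of_int] show ?thesis by simp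
  qed
  then have "real_exponent m - real_exponent l = transpose (real_mat V) *v (\<chi> j. real_of_int (u $ j))"
    by (simp add: real_exponent_def vec_eq_iff matrix_vector_mult_def transpose_def real_mat_def)
  then show ?thesis by (simp add: row_space_def)
qed

lemma newton_polytope_diff:
  fixes V :: "int^'k^'n"
  assumes fg: "homogeneous V d f" "homogeneous V d g"
    and x: "x \<in> newton_polytope f" and y: "y \<in> newton_polytope g"
  shows "x - y \<in> row_space V"
proof -
  have aff: "affine {x. x - p \<in> row_space V}" for p
  proof -
    have "{x. x - p \<in> row_space V} = (\<lambda>z. p + z) ` row_space V"
      by (auto simp: image_iff) (metis add_diff_cancel_left' diff_add_cancel add.commute)
    then show ?thesis
      by (simp add: affine_translation[symmetric] subspace_imp_affine subspace_row_space)
  qed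
  have *: "x - real_exponent l \<in> row_space V" if "l \<in> Poly_Mapping.keys g" for l
  proof -
    have "newton_polytope f \<subseteq> {x. x - real_exponent l \<in> row_space V}"
      unfolding newton_polytope_def
      by (rule hull_minimal) (use homogeneous_exponent_diff[OF fg] that aff affine_imp_convex in auto)
    then show ?thesis using x by blast
  qed
  have "newton_polytope g \<subseteq> {y. y - x \<in> row_space V}"
    unfolding newton_polytope_def
  proof (rule hull_minimal)
    show "real_exponent ` Poly_Mapping.keys g \<subseteq> {y. y - x \<in> row_space V}"
      using subspace_neg[OF subspace_row_space *] by auto
  qed (use aff affine_imp_convex in auto)
  then show ?thesis
    using y subspace_neg[OF subspace_row_space, of "y - x" V] by auto
qed

text \<open>The differences of points of \<^term>\<open>Q\<close> lie in the row space, whose dimension is at most \<open>n\<close>, and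
  they already span a space of dimension \<open>n\<close>. So a form constant on \<^term>\<open>Q\<close> is orthogonal to the
  whole row space.\<close>

lemma constant_on_full_dim_imp_ker:
  fixes V :: "int^'k^'n"
  assumes Q: "Q \<noteq> {}" "aff_dim Q = int CARD('n)"
    and diff: "\<And>x y. x \<in> Q \<Longrightarrow> y \<in> Q \<Longrightarrow> x - y \<in> row_space V"
    and const: "\<And>x y. x \<in> Q \<Longrightarrow> y \<in> Q \<Longrightarrow> w \<bullet> x = w \<bullet> y"
  shows "w \<in> ker_mat (real_mat V)"
proof -
  obtain p where p: "p \<in> Q" using Q(1) by blast
  define D where "D = (\<lambda>x. x - p) ` Q"
  have D: "D \<subseteq> row_space V" using diff p by (auto simp: D_def)
  have "int (dim D) = aff_dim Q"
    using aff_dim_eq_dim_subtract[of p Q] p by (simp add: D_def hull_inc)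
  then have "dim (row_space V) \<le> dim D"
    using Q(2) dim_row_space[of V] by simp
  then have "span D = span (row_space V)"
    using D by (intro dim_eq_span) auto
  then have span: "row_space V = span D"
    using span_eq_iff subspace_row_space by metis
  have "w \<bullet> z = 0" if "z \<in> row_space V" for z
    using that unfolding span
  proof (induction rule: span_induct_alt)
    case base
    show ?case by simp
  next
    case (step c x y)
    then obtain q where "q \<in> Q" "x = q - p" by (auto simp: D_def)
    then have "w \<bullet> x = 0" using const[OF _ p] by (simp add: inner_diff_right)
    then show ?case using step by (simp add: inner_simps)
  qed
  then show ?thesis using orthogonal_row_space_iff by blast
qed

text \<open>Otherwise the linear form would attain its maximum in the relative interior and hence be constant
  on the polytope, which forces \<^term>\<open>w\<close> into the lineality space.\<close>

lemma interior_value_less_max: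
  fixes V :: "int^'k^'n"
  assumes hom: "homogeneous V d g"
    and dim: "aff_dim (newton_polytope g) = int CARD('n)"
    and \<nu>f: "\<nu>f \<in> rel_interior (newton_polytope g)"
    and \<nu>g: "\<nu>g \<in> newton_polytope g" "\<And>\<mu>. \<mu> \<in> newton_polytope g \<Longrightarrow> w \<bullet> \<mu> \<le> w \<bullet> \<nu>g"
    and w: "w \<notin> ker_mat (real_mat V)"
  shows "0 < w \<bullet> (\<nu>g - \<nu>f)"
proof (rule ccontr)
  let ?Q = "newton_polytope g"
  assume "\<not> 0 < w \<bullet> (\<nu>g - \<nu>f)"
  then have "w \<bullet> \<mu> \<le> w \<bullet> \<nu>f" if "\<mu> \<in> ?Q" for \<mu>
    using \<nu>g(2)[OF that] by (simp add: inner_diff_right)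
  then have "w \<bullet> \<mu> = w \<bullet> \<nu>f" if "\<mu> \<in> ?Q" for \<mu>
    using linear_attaining_max_in_rel_interior[OF _ \<nu>f _ that]
    by (simp add: newton_polytope_def convex_convex_hull)
  then have "w \<in> ker_mat (real_mat V)"
    using constant_on_full_dim_imp_ker[OF _ dim newton_polytope_diff[OF hom hom], of w] \<nu>g(1)
    by fastforce
  then show False using w by simp
qed

section \<open>Tropical polynomials on a cone\<close>

text \<open>The face is defined through the relative interior of the cone. Its inequalities are closed
  conditions, so they extend to the closure, which contains the cone.\<close>

lemma face_of_cone_maximizes:
  assumes \<sigma>: "convex \<sigma>" and \<nu>: "\<nu> \<in> face_of_cone Q \<sigma>" and y: "y \<in> \<sigma>" and \<mu>: "\<mu> \<in> Q"
  shows "y \<bullet> \<mu> \<le> y \<bullet> \<nu>"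
proof -
  have "closure (rel_interior \<sigma>) \<subseteq> {y. y \<bullet> \<mu> \<le> y \<bullet> \<nu>}"
    using \<nu> \<mu> by (intro closure_minimal closed_Collect_le continuous_intros) (auto simp: face_of_cone_def)
  then show ?thesis
    using y closure_subset[of \<sigma>] convex_closure_rel_interior[OF \<sigma>] by auto
qed

text \<open>At the exponential of \<^term>\<open>y\<close> every monomial is the exponential of a linear form in its exponent,
  and the maximum of a linear form over the exponents equals its maximum over their convex hull.\<close>

lemma trop_exp:
  fixes f :: "'k::finite cox_ring"
  assumes \<nu>: "\<nu> \<in> newton_polytope f" and max: "\<And>\<mu>. \<mu> \<in> newton_polytope f \<Longrightarrow> y \<bullet> \<mu> \<le> y \<bullet> \<nu>"
  shows "trop f (\<chi> i. exp (y $ i)) = exp (y \<bullet> \<nu>)"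
proof -
  have fne: "Poly_Mapping.keys f \<noteq> {}" using \<nu> by (auto simp: newton_polytope_def)
  have mon: "(\<Prod>i\<in>UNIV. exp (y $ i) ^ Poly_Mapping.lookup m i) = exp (y \<bullet> real_exponent m)" for m
    by (simp add: inner_vec_def real_exponent_def exp_sum exp_of_nat2_mult)
  define M where "M = Max ((\<lambda>m. y \<bullet> real_exponent m) ` Poly_Mapping.keys f)"
  have "newton_polytope f \<subseteq> {\<mu>. y \<bullet> \<mu> \<le> M}"
    unfolding newton_polytope_def M_def
    by (rule hull_minimal) (auto simp: convex_halfspace_le)
  then have "y \<bullet> \<nu> \<le> M" using \<nu> by blast
  moreover have "M \<le> y \<bullet> \<nu>"
    unfolding M_def using fne
    by (auto simp: newton_polytope_def intro!: max hull_inc)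
  ultimately have "M = y \<bullet> \<nu>" by simp
  moreover have "trop f (\<chi> i. exp (y $ i)) = exp M"
    using mono_Max_commute[of exp "(\<lambda>m. y \<bullet> real_exponent m) ` Poly_Mapping.keys f"] fne
    by (simp add: trop_def mon M_def mono_def image_image)
  ultimately show ?thesis by simp
qed

lemma Exp_map_eq: "Exp_map V y = (\<chi> j. exp ((real_mat V *v y) $ j))"
  by (simp add: Exp_map_def cox_map_def vec_eq_iff exp_power_int exp_sum matrix_vector_mult_def real_mat_def)

section \<open>The tropical sector integral\<close>

theorem theorem3p8:
  fixes \<Sigma> :: "(real^'n) set set"
    and V :: "int^'k^'n"
    and f g :: "'k cox_ring"
    and d :: "(int^'k) set"
    and F :: "(real^'k) set set"
    and \<sigma> :: "(real^'k) set"
    and W :: "real^'n^'k"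
    and \<nu>f \<nu>g :: "real^'k"
  assumes fan: "fan_mod {0} \<Sigma>" "complete_fan \<Sigma>" "\<forall>\<rho>\<in>\<Sigma>. rational_cone \<rho>"
    and rays: "ray_matrix \<Sigma> V"
    and nonzero: "f \<noteq> 0" "g \<noteq> 0"
    and pos: "positive_coeffs f" "positive_coeffs g"
    and deg: "d \<in> class_group V" "homogeneous V d f" "homogeneous V d g"
    and dim_g: "aff_dim (newton_polytope g) = int CARD('n)"
    and f_in_g: "newton_polytope f \<subseteq> rel_interior (newton_polytope g)"
    and F_fan: "simplicial_fan_mod (ker_mat (real_mat V)) F"
    and F_refines: "refines_fan F (normal_fan (minkowski_sum (newton_polytope f) (newton_polytope g)))"
    and \<sigma>: "\<sigma> \<in> cones_of_dim_mod (ker_mat (real_mat V)) F CARD('n)"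
    and W_gen: "\<sigma> = cone_mod (ker_mat (real_mat V)) (columns W)"
    and W_orient: "det (real_mat V ** W) > 0"
    and \<nu>f: "\<nu>f extreme_point_of face_of_cone (newton_polytope f) \<sigma>"
    and \<nu>g: "\<nu>g extreme_point_of face_of_cone (newton_polytope g) \<sigma>"
  shows "tropical_sector_integral V f g \<sigma> =
    det (real_mat V ** W) / (\<Prod>l\<in>UNIV. column l W \<bullet> (\<nu>g - \<nu>f))"
proof -
  define K where "K = ker_mat (real_mat V)"
  define M where "M = real_mat V ** W"
  define \<delta> where "\<delta> = \<nu>g - \<nu>f"
  define a where "a = (\<chi> l. column l W \<bullet> \<delta>)"
  define C where "C = {c :: real^'n. \<forall>l. 0 \<le> c $ l}"
  define E where "E = (\<lambda>c. \<chi> j. exp ((M *v c) $ j))"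
  let ?q = "\<lambda>x. trop f x / trop g x"
  have M: "0 < det M" using W_orient by (simp add: M_def)
  have surj: "surj ((*v) (real_mat V))"
  proof -
    obtain N where "M ** N = mat 1"
      using M invertible_det_nz[of M] by (auto simp: invertible_def)
    then have "real_mat V *v (W *v (N *v z)) = z" for z
      by (simp add: matrix_vector_mul_assoc M_def matrix_mul_assoc)
    then show ?thesis by (rule surjI)
  qed
  have \<sigma>_eq: "\<sigma> = {u + W *v c |u c. u \<in> K \<and> c \<in> C}"
    unfolding W_gen cone_mod_def convex_cone_hull_columns K_def C_def by blast
  have K0: "0 \<in> K" by (simp add: K_def ker_mat_def)
  have "\<sigma> \<in> F" using \<sigma> by (simp add: cones_of_dim_mod_def)
  then have "convex \<sigma>"
    using F_fan by (auto simp: simplicial_fan_mod_def fan_mod_def convex_cone_def)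
  have in_\<sigma>: "W *v c \<in> \<sigma>" if "c \<in> C" for c
    unfolding \<sigma>_eq using that K0 by (auto intro!: exI[of _ 0] exI[of _ c])
  have \<nu>f': "\<nu>f \<in> face_of_cone (newton_polytope f) \<sigma>" and \<nu>g': "\<nu>g \<in> face_of_cone (newton_polytope g) \<sigma>"
    using \<nu>f \<nu>g by (auto simp: extreme_point_of_def)
  then have \<nu>_in: "\<nu>f \<in> newton_polytope f" "\<nu>g \<in> newton_polytope g"
    by (auto simp: face_of_cone_def)
  note max_f = face_of_cone_maximizes[OF \<open>convex \<sigma>\<close> \<nu>f']
  note max_g = face_of_cone_maximizes[OF \<open>convex \<sigma>\<close> \<nu>g']
  \<comment> \<open>Invertibility of \<^term>\<open>M\<close> keeps the generators out of the lineality space.\<close>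
  have a_pos: "0 < a $ l" for l
  proof -
    have axis: "axis l 1 \<in> C" by (simp add: C_def, simp add: axis_def)
    have col: "W *v axis l 1 = column l W" by (simp add: matrix_vector_mult_basis)
    have "M *v axis l 1 \<noteq> 0"
    proof
      assume "M *v axis l 1 = 0"
      moreover obtain N where "N ** M = mat 1"
        using M invertible_det_nz[of M] by (auto simp: invertible_def)
      ultimately have "axis l (1::real) = 0"
        by (metis matrix_vector_mul_assoc matrix_vector_mul_lid matrix_vector_mult_0_right)
      then show False by (simp add: axis_eq_0_iff)
    qed
    then have "column l W \<notin> ker_mat (real_mat V)"
      by (simp add: ker_mat_def M_def col flip: matrix_vector_mul_assoc)
    then show ?thesis
      using interior_value_less_max[OF deg(3) dim_g _ \<nu>_in(2) max_g] in_\<sigma>[OF axis] \<nu>_in(1) f_in_g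
      by (auto simp: a_def \<delta>_def col)
  qed
  have Exp: "Exp_map V (u + W *v c) = E c" if "u \<in> K" for u c
    using that
    by (simp add: Exp_map_eq E_def M_def K_def ker_mat_def matrix_vector_right_distrib matrix_vector_mul_assoc)
  \<comment> \<open>\<^const>\<open>Exp_map\<close> does not see the lineality space, so the generators alone parametrize the image.\<close>
  have image: "Exp_map V ` \<sigma> = E ` C"
    unfolding \<sigma>_eq by (auto simp: Exp image_iff) (metis Exp K0)
  have integrand: "descend_fun V ?q (E c) * canonical_form V (E c) (\<chi> b. axis b 1) =
      exp (- (a \<bullet> c)) / (\<Prod>j\<in>UNIV. E c $ j)" if c: "c \<in> C" for c
  proof -
    \<comment> \<open>The descended function may be evaluated at any representative in the positive orthant.\<close>
    define y where "y = W *v c"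
    have y: "y \<in> \<sigma>" using in_\<sigma>[OF c] by (simp add: y_def)
    have E: "E c = cox_map V (\<chi> i. exp (y $ i))"
      using Exp[OF K0, of c] by (simp add: Exp_map_def y_def)
    have "descend_fun V ?q (E c) = ?q (\<chi> i. exp (y $ i))"
      unfolding E
      by (rule trop_quotient_descends[OF nonzero(1) deg(2) nonzero(2) deg(3)]) (simp add: pos_orthant_def)
    also have "\<dots> = exp (- (y \<bullet> \<delta>))"
      by (simp add: trop_exp[OF \<nu>_in(1) max_f[OF y]] trop_exp[OF \<nu>_in(2) max_g[OF y]]
          \<delta>_def inner_diff_right exp_diff[symmetric])
    also have "y \<bullet> \<delta> = a \<bullet> c"
      by (simp add: y_def a_def matrix_mult_sum scalar_mult_eq_scaleR inner_sum_left inner_vec_def[of "vec_lambda _"] mult.commute)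
    finally have "descend_fun V ?q (E c) = exp (- (a \<bullet> c))" .
    moreover have "canonical_form V (E c) (\<chi> b. axis b 1) = 1 / (\<Prod>j\<in>UNIV. E c $ j)"
    proof -
      have "(\<chi> b. axis b 1) = (mat 1 :: real^'n^'n)"
        by (simp add: mat_def axis_def vec_eq_iff)
      then show ?thesis
        by (subst canonical_form_eq[OF surj]) (simp_all add: E_def pos_orthant_def)
    qed
    ultimately show ?thesis by simp
  qed
  have "tropical_sector_integral V f g \<sigma> =
      (LINT t:E ` C|lborel. descend_fun V ?q t * canonical_form V t (\<chi> b. axis b 1))"
    by (simp add: tropical_sector_integral_def form_integral_def image)
  also have "\<dots> = \<bar>det M\<bar> / (\<Prod>l\<in>UNIV. a $ l)"
    unfolding E_def C_def
    by (rule exp_cone_integral) (use M a_pos integrand in \<open>auto simp: E_def C_def\<close>)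
  finally show ?thesis
    using M by (simp add: M_def a_def \<delta>_def)
qed

end
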